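(* Let $N=N_{\mathrm{grid}}\ge 1$, $a,b\in\mathbb{R}^d$, and $\lambda>0$. Let $G$ be a smooth field of symmetric positive definite $d\times d$ matrices and $S$ a smooth real-valued function on $\mathbb{R}^d$. Given a current iterate $(z^{(k)}_s)_{s=0}^{N}$, $(u^{(k)}_s)_{s=0}^{N-1}$ in $\mathbb{R}^d$, set $$G_s:=G\big(z^{(k)}_s\big)\ (s=0,\dots,N-1),\qquad \nu_s:=\nabla_y\Big((u^{(k)}_s)^{\top}G(y)u^{(k)}_s+\lambda S(y)\Big)\Big|_{y=z_s^{(k)}}\ (s=1,\dots,N-1).$$ Then the system, in the unknowns $u_s,\mu_s\in\mathbb{R}^d$ ($s=0,\dots,N-1$), $$2G_su_s+\mu_s=0\ (s=0,\dots,N-1),\qquad \nu_s+\mu_s=\mu_{s-1}\ (s=1,\dots,N-1),\qquad \sum_{s=0}^{N-1}u_s=b-a,$$ is solved by the update scheme $$\mu_{N-1}=\Big(\sum_{s=0}^{N-1}G_s^{-1}\Big)^{-1}\Big(2(a-b)-\sum_{s=0}^{N-1}G_s^{-1}\sum_{j=s+1}^{N-1}\nu_j\Big),$$ $$u_s=-\tfrac12G_s^{-1}\Big(\mu_{N-1}+\sum_{j=s+1}^{N-1}\nu_j\Big),\quad s=0,\dots,N-1,$$ and the corresponding new states are $z_0=a$, $z_{s+1}=z_s+u_s$ for $s=0,\dots,N-1$.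
   Context: The setting is the discrete control problem $\min_{(z_s,u_s)}\sum_{s=0}^{N-1}\big(u_s^{\top}G(z_s)u_s+\lambda S(z_s)\big)$ subject to $z_{s+1}=z_s+u_s$ ($s=0,\dots,N-1$), $z_0=a$, $z_N=b$, in a local coordinate chart identified with $\mathbb{R}^d$, where $G$ is the matrix of the Riemannian metric. The displayed system consists of the first-order necessary conditions of this problem, with multipliers $\mu_s$, after freezing the matrices $G(z_s)$ and the state-gradient terms at the current iterate. Empty sums are zero. *)

theory Defs
  imports "HOL-Analysis.Analysis"
begin

text \<open>
  \<open>C_k k f\<close> says that \<open>f\<close> is \<open>k\<close> times continuously differentiable on the whole space: higher
  derivatives are taken through the directional derivatives, which on a finite-dimensional
  domain is the usual notion.
\<close>

primrec C_k :: "nat \<Rightarrow> ('a::euclidean_space \<Rightarrow> 'b::real_normed_vector) \<Rightarrow> bool" where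
  "C_k 0 f \<longleftrightarrow> continuous_on UNIV f"
| "C_k (Suc k) f \<longleftrightarrow>
     (\<forall>x. f differentiable (at x)) \<and> (\<forall>v. C_k k (\<lambda>x. frechet_derivative f (at x) v))"

definition smooth :: "('a::euclidean_space \<Rightarrow> 'b::real_normed_vector) \<Rightarrow> bool" where
  "smooth f \<longleftrightarrow> (\<forall>k. C_k k f)"

definition sym_pos_def :: "real^'d^'d \<Rightarrow> bool" where
  "sym_pos_def A \<longleftrightarrow> transpose A = A \<and> (\<forall>x. x \<noteq> 0 \<longrightarrow> x \<bullet> (A *v x) > 0)"

text \<open>
  The first-order conditions with frozen matrices \<open>A s\<close> and frozen state gradients \<open>\<nu> s\<close>.
  Only the values \<open>u s\<close> and \<open>\<mu> s\<close> with \<open>s < N\<close> are constrained.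
\<close>

definition frozen_system ::
  "nat \<Rightarrow> (nat \<Rightarrow> real^'d^'d) \<Rightarrow> (nat \<Rightarrow> real^'d) \<Rightarrow> real^'d \<Rightarrow> real^'d \<Rightarrow>
   (nat \<Rightarrow> real^'d) \<Rightarrow> (nat \<Rightarrow> real^'d) \<Rightarrow> bool" where
  "frozen_system N A \<nu> a b u \<mu> \<longleftrightarrow>
     (\<forall>s\<in>{0..N - 1}. 2 *\<^sub>R (A s *v u s) + \<mu> s = 0) \<and>
     (\<forall>s\<in>{1..N - 1}. \<nu> s + \<mu> s = \<mu> (s - 1)) \<and>
     (\<Sum>s=0..N - 1. u s) = b - a"

end

theory Submission
  imports Defs
begin

text \<open>
  The multiplier recursion telescopes to \<open>\<mu> s = \<mu> (N - 1) + (\<Sum>j=s+1..N - 1. \<nu> j)\<close>; stationarity then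
  expresses every \<open>u s\<close> through \<open>\<mu> (N - 1)\<close>, and the endpoint constraint becomes a linear equation
  for \<open>\<mu> (N - 1)\<close> whose matrix, a sum of inverses of positive definite matrices, is positive
  definite and hence invertible.
\<close>

text \<open>A kernel vector \<open>x\<close> would satisfy \<open>x \<bullet> (A *v x) = 0\<close>,
  so positivity forces \<open>x = 0\<close>; a square matrix with trivial kernel is
  invertible.\<close>

lemma sym_pos_def_invertible:
  assumes "sym_pos_def A"
  shows "invertible A"
proof -
  have "x = 0" if "A *v x = 0" for x
    using assms that unfolding sym_pos_def_def by force
  then show ?thesis
    by (metis invertible_left_inverse matrix_left_invertible_ker)
qed

lemma matrix_inv:
  fixes A :: "real^'d^'d"
  assumes "invertible A"
  shows "A ** matrix_inv A = mat 1" and "matrix_inv A ** A = mat 1"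
proof -
  have "A ** matrix_inv A = mat 1 \<and> matrix_inv A ** A = mat 1"
    unfolding matrix_inv_def by (rule someI_ex) (use assms in \<open>simp add: invertible_def\<close>)
  then show "A ** matrix_inv A = mat 1" and "matrix_inv A ** A = mat 1"
    by auto
qed

lemma matrix_inv_mult_vector:
  fixes A :: "real^'d^'d"
  assumes "invertible A"
  shows "A *v (matrix_inv A *v x) = x" and "matrix_inv A *v (A *v x) = x"
  using matrix_inv[OF assms] by (simp_all add: matrix_vector_mul_assoc)

lemma matrix_inv_mult_vector_eq_iff:
  fixes A :: "real^'d^'d"
  assumes "invertible A"
  shows "A *v x = y \<longleftrightarrow> x = matrix_inv A *v y"
  using matrix_inv_mult_vector[OF assms] by auto

text \<open>Transposing \<open>A ** matrix_inv A = mat 1\<close> yields a left inverse of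
  \<open>transpose A\<close>, and a left inverse agrees with the two-sided one.\<close>

lemma transpose_matrix_inv:
  fixes A :: "real^'d^'d"
  assumes "invertible A"
  shows "transpose (matrix_inv A) = matrix_inv (transpose A)"
proof -
  let ?B = "transpose (matrix_inv A)"
  have left: "?B ** transpose A = mat 1"
    by (simp add: matrix_transpose_mul[symmetric] matrix_inv(1)[OF assms])
  have "?B = ?B ** (transpose A ** matrix_inv (transpose A))"
    by (simp add: matrix_inv(1)[OF transpose_invertible[OF assms]])
  also have "\<dots> = matrix_inv (transpose A)"
    by (simp add: matrix_mul_assoc left)
  finally show ?thesis .
qed

text \<open>The substitution \<open>x = A *v y\<close> turns the quadratic form of the inverse at
  \<open>x\<close> into the quadratic form of \<open>A\<close> at \<open>y\<close>.\<close>

lemma sym_pos_def_matrix_inv: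
  assumes "sym_pos_def A"
  shows "sym_pos_def (matrix_inv A)"
  unfolding sym_pos_def_def
proof (intro conjI allI impI)
  note inv = sym_pos_def_invertible[OF assms]
  show "transpose (matrix_inv A) = matrix_inv A"
    using assms transpose_matrix_inv[OF inv] by (simp add: sym_pos_def_def)
  fix x :: "real^'a"
  assume "x \<noteq> 0"
  define y where "y = matrix_inv A *v x"
  have x: "x = A *v y"
    using matrix_inv_mult_vector(1)[OF inv] by (simp add: y_def)
  with \<open>x \<noteq> 0\<close> have "y \<noteq> 0"
    by auto
  then have "y \<bullet> (A *v y) > 0"
    using assms by (simp add: sym_pos_def_def)
  then show "x \<bullet> (matrix_inv A *v x) > 0"
    by (simp add: x[symmetric] y_def[symmetric] inner_commute)
qed

lemma sym_pos_def_add: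
  assumes "sym_pos_def A" "sym_pos_def B"
  shows "sym_pos_def (A + B)"
  using assms unfolding sym_pos_def_def
  by (simp add: transpose_def vec_eq_iff matrix_vector_mult_add_rdistrib inner_add_right add_pos_pos)

text \<open>The index set must be nonempty, since the empty sum is the zero matrix, which is not
  positive definite.\<close>

lemma sym_pos_def_sum:
  assumes "finite I" "I \<noteq> {}" "\<And>i. i \<in> I \<Longrightarrow> sym_pos_def (A i)"
  shows "sym_pos_def (\<Sum>i\<in>I. A i)"
  using assms by (induction I rule: finite_ne_induct) (auto intro: sym_pos_def_add)

lemma sum_matrix_vector_mult:
  fixes A :: "'i \<Rightarrow> real^'n^'m"
  shows "(\<Sum>i\<in>I. A i) *v x = (\<Sum>i\<in>I. A i *v x)"
  by (induction I rule: infinite_finite_induct) (auto simp: matrix_vector_mult_add_rdistrib)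

text \<open>Telescoping from the terminal index \<open>n\<close> downwards. An equivalence is
  needed: one direction verifies the scheme, the other shows that every solution has this form. At
  \<open>s = n\<close> the sum is empty and the closed form is trivial.\<close>

lemma backward_recursion_iff:
  fixes \<nu> \<mu> :: "nat \<Rightarrow> 'a::ab_group_add"
  shows "(\<forall>s\<in>{1..n}. \<nu> s + \<mu> s = \<mu> (s - 1)) \<longleftrightarrow>
         (\<forall>s\<in>{0..n}. \<mu> s = \<mu> n + (\<Sum>j=s+1..n. \<nu> j))" (is "?L \<longleftrightarrow> ?R")
proof
  assume L: ?L
  show ?R
  proof
    fix s assume "s \<in> {0..n}"
    then have "s \<le> n" by simp
    then show "\<mu> s = \<mu> n + (\<Sum>j=s+1..n. \<nu> j)"
    proof (induction s rule: inc_induct)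
      case base
      show ?case by simp
    next
      case (step s)
      have "\<mu> s = \<nu> (Suc s) + \<mu> (Suc s)"
        using L step.hyps by force
      also have "\<dots> = \<mu> n + (\<Sum>j=s+1..n. \<nu> j)"
        using step by (simp add: sum.atLeast_Suc_atMost[of "Suc s"] algebra_simps)
      finally show ?case .
    qed
  qed
next
  assume R: ?R
  show ?L
  proof
    fix s assume "s \<in> {1..n}"
    \<comment> \<open>Subtraction on naturals truncates; \<open>s \<ge> 1\<close> makes
      \<open>s - 1 + 1 = s\<close> valid, so the closed form at \<open>s - 1\<close> is a sum
      starting at \<open>s\<close>.\<close>
    then have "s \<in> {0..n}" "s - 1 \<in> {0..n}" and eq: "s - 1 + 1 = s"
      by auto
    from this(1,2)[THEN R[rule_format]]
    have "\<mu> s = \<mu> n + (\<Sum>j=s+1..n. \<nu> j)" "\<mu> (s - 1) = \<mu> n + (\<Sum>j=s..n. \<nu> j)"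
      unfolding eq .
    moreover have "(\<Sum>j=s..n. \<nu> j) = \<nu> s + (\<Sum>j=s+1..n. \<nu> j)"
      using \<open>s \<in> {1..n}\<close> by (simp add: sum.atLeast_Suc_atMost)
    ultimately show "\<nu> s + \<mu> s = \<mu> (s - 1)"
      by (simp only: add.left_commute)
  qed
qed

text \<open>Solves the system by equivalences only, so that existence and uniqueness can both be
  read off.\<close>

lemma frozen_system_iff:
  fixes A :: "nat \<Rightarrow> real^'d^'d"
  assumes inv: "\<forall>s\<in>{0..N - 1}. invertible (A s)"
    and invM: "invertible (\<Sum>s=0..N - 1. matrix_inv (A s))"
  shows "frozen_system N A \<nu> a b u \<mu> \<longleftrightarrow>
    \<mu> (N - 1) = matrix_inv (\<Sum>s=0..N - 1. matrix_inv (A s)) *v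
       (2 *\<^sub>R (a - b) - (\<Sum>s=0..N - 1. matrix_inv (A s) *v (\<Sum>j=s+1..N - 1. \<nu> j))) \<and>
    (\<forall>s\<in>{0..N - 1}. \<mu> s = \<mu> (N - 1) + (\<Sum>j=s+1..N - 1. \<nu> j) \<and>
       u s = - (1/2) *\<^sub>R (matrix_inv (A s) *v (\<mu> (N - 1) + (\<Sum>j=s+1..N - 1. \<nu> j))))"
    (is "_ \<longleftrightarrow> ?last \<and> (\<forall>s\<in>?I. ?mu s \<and> ?u s)")
proof -
  let ?T = "\<lambda>s. \<Sum>j=s+1..N - 1. \<nu> j"
  have stationarity: "2 *\<^sub>R (A s *v u s) + \<mu> s = 0 \<longleftrightarrow> ?u s" if "s \<in> ?I" "?mu s" for s
  proof -
    \<comment> \<open>The scalar moves inside the product so that the equation has the shape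
      \<open>A *v x = y\<close> and can be inverted.\<close>
    have "2 *\<^sub>R (A s *v u s) + \<mu> s = 0 \<longleftrightarrow> A s *v (- 2 *\<^sub>R u s) = \<mu> s"
      by (simp only: matrix_vector_mult_scaleR) (simp add: neg_eq_iff_add_eq_0)
    also have "\<dots> \<longleftrightarrow> - 2 *\<^sub>R u s = matrix_inv (A s) *v \<mu> s"
      by (rule matrix_inv_mult_vector_eq_iff[OF inv[rule_format, OF that(1)]])
    also have "\<dots> \<longleftrightarrow> u s = - (1/2) *\<^sub>R (matrix_inv (A s) *v \<mu> s)"
      unfolding vec_eq_iff by (intro iff_allI) auto
    finally show ?thesis
      by (simp only: that(2)[symmetric])
  qed
  have endpoint: "(\<Sum>s\<in>?I. u s) = b - a \<longleftrightarrow> ?last" if "\<forall>s\<in>?I. ?u s"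
  proof -
    have "(\<Sum>s\<in>?I. u s) = (\<Sum>s\<in>?I. - (1/2) *\<^sub>R (matrix_inv (A s) *v (\<mu> (N - 1) + ?T s)))"
      by (rule sum.cong[OF refl]) (rule that[rule_format])
    also have "\<dots> = - (1/2) *\<^sub>R ((\<Sum>s\<in>?I. matrix_inv (A s)) *v \<mu> (N - 1)
        + (\<Sum>s\<in>?I. matrix_inv (A s) *v ?T s))"
      by (simp only: scaleR_sum_right[symmetric] matrix_vector_right_distrib sum.distrib
          sum_matrix_vector_mult)
    finally have sum_u: "(\<Sum>s\<in>?I. u s) = \<dots>" .
    \<comment> \<open>Used with \<open>v\<close> the summed inverses applied to
      \<open>\<mu> (N - 1)\<close> and \<open>t\<close> the contribution of the \<nu> terms;
      inverting that sum then isolates \<open>\<mu> (N - 1)\<close>.\<close>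
    have "- (1/2) *\<^sub>R (v + t) = b - a \<longleftrightarrow> v = 2 *\<^sub>R (a - b) - t" for v t
      unfolding vec_eq_iff by (intro iff_allI) (auto simp: field_simps)
    then show ?thesis
      by (simp only: sum_u matrix_inv_mult_vector_eq_iff[OF invM])
  qed
  show ?thesis
    \<comment> \<open>The recursion becomes its closed form; given that, stationarity is equivalent
      to the formula for \<open>u\<close>, and given this formula the endpoint condition is
      equivalent to that for \<open>\<mu> (N - 1)\<close>.\<close>
    unfolding frozen_system_def backward_recursion_iff
    using stationarity endpoint by blast
qed

theorem proposition3p4:
  fixes N :: nat
    and a b :: "real^'d"
    and lam :: real
    and G :: "real^'d \<Rightarrow> real^'d^'d"
    and S :: "real^'d \<Rightarrow> real"
    and zk uk \<nu> u z :: "nat \<Rightarrow> real^'d"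
    and Gs :: "nat \<Rightarrow> real^'d^'d"
    and \<mu>_last :: "real^'d"
  assumes "N \<ge> 1"
    and "lam > 0"
    and "smooth G"
    and "\<And>y. sym_pos_def (G y)"
    and "smooth S"
    and Gs: "\<And>s. s \<in> {0..N - 1} \<Longrightarrow> Gs s = G (zk s)"
    and \<nu>: "\<And>s. s \<in> {1..N - 1} \<Longrightarrow>
           GDERIV (\<lambda>y. uk s \<bullet> (G y *v uk s) + lam * S y) (zk s) :> \<nu> s"
    and scheme_\<mu>:
      "\<mu>_last = matrix_inv (\<Sum>s=0..N - 1. matrix_inv (Gs s)) *v
         (2 *\<^sub>R (a - b) - (\<Sum>s=0..N - 1. matrix_inv (Gs s) *v (\<Sum>j=s+1..N - 1. \<nu> j)))"
    and scheme_u: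
      "\<And>s. s \<in> {0..N - 1} \<Longrightarrow>
         u s = - (1/2) *\<^sub>R (matrix_inv (Gs s) *v (\<mu>_last + (\<Sum>j=s+1..N - 1. \<nu> j)))"
    and scheme_z: "z 0 = a" "\<And>s. s \<in> {0..N - 1} \<Longrightarrow> z (s + 1) = z s + u s"
  shows "(\<forall>s\<in>{0..N - 1}. invertible (Gs s)) \<and>
         invertible (\<Sum>s=0..N - 1. matrix_inv (Gs s)) \<and>
         (\<exists>\<mu>. \<mu> (N - 1) = \<mu>_last \<and> frozen_system N Gs \<nu> a b u \<mu>) \<and>
         (\<forall>u' \<mu>'. frozen_system N Gs \<nu> a b u' \<mu>' \<longrightarrow>
            \<mu>' (N - 1) = \<mu>_last \<and> (\<forall>s\<in>{0..N - 1}. u' s = u s)) \<and>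
         z N = b"
proof -
  have spd: "sym_pos_def (Gs s)" if "s \<in> {0..N - 1}" for s
    using assms(4) Gs[OF that] by simp
  have inv: "\<forall>s\<in>{0..N - 1}. invertible (Gs s)"
    using sym_pos_def_invertible[OF spd] by blast
  have invM: "invertible (\<Sum>s=0..N - 1. matrix_inv (Gs s))"
    by (intro sym_pos_def_invertible sym_pos_def_sum sym_pos_def_matrix_inv spd) auto
  note iff = frozen_system_iff[of N Gs, OF inv invM]
  \<comment> \<open>The scheme prescribes only the last multiplier; the closed form of the recursion
    supplies the others.\<close>
  define \<mu> where "\<mu> s = \<mu>_last + (\<Sum>j=s+1..N - 1. \<nu> j)" for s
  have last: "\<mu> (N - 1) = \<mu>_last"
    unfolding \<mu>_def by simp
  have sol: "frozen_system N Gs \<nu> a b u \<mu>"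
    unfolding iff last unfolding \<mu>_def using scheme_\<mu> scheme_u by blast
  have unique: "\<mu>' (N - 1) = \<mu>_last \<and> (\<forall>s\<in>{0..N - 1}. u' s = u s)"
    if "frozen_system N Gs \<nu> a b u' \<mu>'" for u' \<mu>'
  proof -
    have last': "\<mu>' (N - 1) = \<mu>_last"
      using that unfolding iff scheme_\<mu>[symmetric] by blast
    have "\<forall>s\<in>{0..N - 1}.
        u' s = - (1/2) *\<^sub>R (matrix_inv (Gs s) *v (\<mu>_last + (\<Sum>j=s+1..N - 1. \<nu> j)))"
      using that unfolding iff last' by blast
    with last' scheme_u show ?thesis
      by metis
  qed
  \<comment> \<open>At \<open>n = N\<close> this turns the endpoint constraint on the sum of the
    controls into \<open>z N = b\<close>.\<close>
  have "z n = a + (\<Sum>s<n. u s)" if "n \<le> N" for n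
    using that
  proof (induction n)
    case 0
    show ?case using scheme_z(1) by simp
  next
    case (Suc n)
    then show ?case using scheme_z(2)[of n] by (simp add: algebra_simps)
  qed
  \<comment> \<open>For \<open>N = 0\<close> truncated subtraction would make the right side
    \<open>{0}\<close>, hence the appeal to \<open>N \<ge> 1\<close>.\<close>
  moreover have "{..<N} = {0..N - 1}"
    using \<open>N \<ge> 1\<close> by auto
  ultimately have "z N = b"
    using sol by (simp add: frozen_system_def)
  then show ?thesis
    using inv invM last sol unique by blast
qed

end
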